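(* Let $A:\mathbb{R}^M\to\mathcal{U}$ be a linear map (linear algorithm), let $u^{\rm true}\in\mathcal{U}$ and $\mathbf{y}\in\mathbb{R}^M$. Then $$ \| A(\mathbf{y}) - u^{\rm true} \| \leq \Lambda_{2}(A)\,\| \mathbf{y} - \boldsymbol{\ell}(u^{\rm true}) \|_2 + \Lambda_{\mathcal{U}}(A)\,\| \Pi_{{\rm Im}(A)^{\perp}} u^{\rm true} \| + \Lambda_{\mathcal{U}}^{\rm bias}(A)\,\| u^{\rm true} \| . $$ Furthermore, if $\mathbf{y} = \boldsymbol{\ell}(u^{\rm true}) + \boldsymbol{\epsilon}$, where $\epsilon_1,\ldots,\epsilon_M$ are independent identically distributed real random variables with mean $0$ and variance $\sigma^2$, then $$ \mathbb{E}\left[ \| A(\mathbf{y}) - u^{\rm true} \|^2 \right] \leq \left( \Lambda_{\mathcal{U}}(A)\,\| \Pi_{{\rm Im}(A)^{\perp}} u^{\rm true} \| + \Lambda_{\mathcal{U}}^{\rm bias}(A)\,\| u^{\rm true} \| \right)^2 + \sigma^2\, {\rm trace}\left( \mathbf{A}^T \mathbf{A} \right). $$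
   Context: $\mathcal{U}$ is a real Hilbert space with inner product $(\cdot,\cdot)$ and norm $\|\cdot\|$; $\ell_1,\ldots,\ell_M\in\mathcal{U}'$ are linearly independent bounded linear functionals and $\boldsymbol{\ell}=[\ell_1,\ldots,\ell_M]^T:\mathcal{U}\to\mathbb{R}^M$. $\|\cdot\|_2$ is the Euclidean norm. For a closed subspace $\mathcal{Q}\subset\mathcal{U}$, $\mathcal{Q}^\perp$ is its orthogonal complement and $\Pi_{\mathcal{Q}}$ the orthogonal projection onto $\mathcal{Q}$. For a linear map $A:\mathbb{R}^M\to\mathcal{U}$: ${\rm Im}(A)=\{A(\mathbf{y}):\mathbf{y}\in\mathbb{R}^M\}$, $Q=\dim{\rm Im}(A)\le M$, $\{\psi_q\}_{q=1}^Q$ is an orthonormal basis of ${\rm Im}(A)$, and $A_{\boldsymbol{\ell}}:\mathcal{U}\to\mathcal{U}$ is defined by $A_{\boldsymbol{\ell}}(u)=A(\boldsymbol{\ell}(u))$. The matrix $\mathbf{A}\in\mathbb{R}^{Q,M}$ has entries $\mathbf{A}_{q,m}=(A(\mathbf{e}_m),\psi_q)$, where $\{\mathbf{e}_m\}_m$ is the canonical basis of $\mathbb{R}^M$. The stability constants are the operator norms (suprema over nonzero vectors) $$ \Lambda_2(A)=\sup_{\mathbf{y}\in\mathbb{R}^M}\frac{\|A(\mathbf{y})\|}{\|\mathbf{y}\|_2},\qquad \Lambda_{\mathcal{U}}(A)=\sup_{u\in\mathcal{U}}\frac{\|u-A_{\boldsymbol{\ell}}(u)\|}{\|u\|},\qquad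 \Lambda_{\mathcal{U}}^{\rm bias}(A)=\sup_{u\in{\rm Im}(A)}\frac{\|u-A_{\boldsymbol{\ell}}(u)\|}{\|u\|}. $$ *)

theory Defs
  imports "HOL-Probability.Probability"
begin

text \<open>The dual space of \<open>'u\<close> is the library type \<open>'u \<Rightarrow>\<^sub>L real\<close> of bounded linear functionals.\<close>

definition meas :: "('m \<Rightarrow> 'u::real_normed_vector \<Rightarrow>\<^sub>L real) \<Rightarrow> 'u \<Rightarrow> real ^ 'm"
  where "meas l u = (\<chi> i. blinfun_apply (l i) u)"

definition alg_meas ::
  "(real ^ 'm \<Rightarrow> 'u) \<Rightarrow> ('m \<Rightarrow> 'u::real_normed_vector \<Rightarrow>\<^sub>L real) \<Rightarrow> 'u \<Rightarrow> 'u"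
  where "alg_meas A l u = A (meas l u)"

text \<open>
  The value is unique if it exists. It exists for every \<open>u\<close> if \<open>S\<close> is a closed subspace of
  a Hilbert space. The library's \<open>closest_point\<close> only covers the finite-dimensional case.
\<close>

definition orth_proj :: "'u::real_inner set \<Rightarrow> 'u \<Rightarrow> 'u"
  where "orth_proj S u = (THE p. p \<in> S \<and> u - p \<in> orthogonal_comp S)"

text \<open>
  Since \<open>0 / 0 = 0\<close> in HOL and all the other quotients are nonnegative, including \<open>u = 0\<close>
  in the suprema below (as \<open>onorm\<close> does) does not change their values; it only makes the
  supremum \<open>0\<close> when there is no nonzero vector.
\<close>

definition Lambda2 :: "(real ^ 'm::finite \<Rightarrow> 'u::real_normed_vector) \<Rightarrow> real"
  where "Lambda2 A = onorm A"

definition LambdaU ::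
  "(real ^ 'm \<Rightarrow> 'u) \<Rightarrow> ('m \<Rightarrow> 'u::real_normed_vector \<Rightarrow>\<^sub>L real) \<Rightarrow> real"
  where "LambdaU A l = onorm (\<lambda>u. u - alg_meas A l u)"

definition LambdaU_bias ::
  "(real ^ 'm \<Rightarrow> 'u) \<Rightarrow> ('m \<Rightarrow> 'u::real_normed_vector \<Rightarrow>\<^sub>L real) \<Rightarrow> real"
  where "LambdaU_bias A l = (SUP u \<in> range A. norm (u - alg_meas A l u) / norm u)"

definition orthonormal_basis :: "nat \<Rightarrow> (nat \<Rightarrow> 'u::real_inner) \<Rightarrow> 'u set \<Rightarrow> bool"
  where "orthonormal_basis Q \<psi> S \<longleftrightarrow>
    (\<forall>p<Q. \<forall>q<Q. inner (\<psi> p) (\<psi> q) = (if p = q then 1 else 0)) \<and>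
    span (\<psi> ` {..<Q}) = S"

text \<open>
  The entries of the \<open>Q \<times> M\<close> matrix of \<open>A\<close>. Its rows are indexed by the numbers
  \<open>q < Q\<close> and not by a finite type, because \<open>Q = dim (range A)\<close> depends on \<open>A\<close> and may
  be \<open>0\<close>.
\<close>

definition alg_mat ::
  "(real ^ 'm::finite \<Rightarrow> 'u::real_inner) \<Rightarrow> (nat \<Rightarrow> 'u) \<Rightarrow> nat \<Rightarrow> 'm \<Rightarrow> real"
  where "alg_mat A \<psi> q m = inner (A (axis m 1)) (\<psi> q)"

text \<open>The product \<open>B\<^sup>T B\<close> for a matrix \<open>B\<close> with rows \<open>q < Q\<close>.\<close>

definition transpose_mult_self :: "nat \<Rightarrow> (nat \<Rightarrow> 'm \<Rightarrow> real) \<Rightarrow> real ^ 'm ^ 'm::finite"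
  where "transpose_mult_self Q B = (\<chi> m n. \<Sum>q<Q. B q m * B q n)"

definition iid :: "'w measure \<Rightarrow> ('m \<Rightarrow> 'w \<Rightarrow> real) \<Rightarrow> bool"
  where "iid P X \<longleftrightarrow>
    prob_space.indep_vars P (\<lambda>_. borel) X UNIV \<and>
    (\<forall>i j. distr P borel (X i) = distr P borel (X j))"

text \<open>
  Square integrability is part of having a variance: HOL's integral of a non-integrable
  function is \<open>0\<close>. On a probability space it also gives integrability of \<open>X\<close>.
\<close>

definition has_mean_variance :: "'w measure \<Rightarrow> ('w \<Rightarrow> real) \<Rightarrow> real \<Rightarrow> real \<Rightarrow> bool"
  where "has_mean_variance P X \<mu> v \<longleftrightarrow>
    X \<in> borel_measurable P \<and> integrable P (\<lambda>w. (X w)\<^sup>2) \<and>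
    prob_space.expectation P X = \<mu> \<and> prob_space.variance P X = v"

end

theory Submission
  imports Defs
begin

text \<open>
  Write \<open>R u = u - A (l u)\<close>. Then \<open>A y - u = A (y - l u) - R u\<close>. Splitting
  \<open>u\<close> orthogonally into its parts in and orthogonal to the range of \<open>A\<close> bounds
  \<open>R u\<close> by the last two terms of the first estimate. For random noise the cross terms of
  \<open>\<parallel>A \<epsilon> - R u\<parallel>\<^sup>2\<close> have mean zero, so that only \<open>\<parallel>R u\<parallel>\<^sup>2\<close> and
  \<open>\<sigma>\<^sup>2 \<Sum>\<^sub>m \<parallel>A e\<^sub>m\<parallel>\<^sup>2\<close> remain; Parseval's identity turns the latter sum into
  the trace.
\<close>

section \<open>Finite orthonormal bases and orthogonal projection\<close>

text \<open>Both sides are linear in \<open>x\<close> and agree on every \<open>\<psi> p\<close>,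
  hence on the whole span.\<close>

lemma orthonormal_basis_expansion:
  assumes basis: "orthonormal_basis Q \<psi> S" and "x \<in> S"
  shows "(\<Sum>q<Q. inner x (\<psi> q) *\<^sub>R \<psi> q) = x"
proof -
  let ?F = "\<lambda>x. \<Sum>q<Q. inner x (\<psi> q) *\<^sub>R \<psi> q"
  have "linear ?F"
    by (intro linearI)
      (simp_all add: inner_add_left scaleR_add_left sum.distrib scaleR_sum_right)
  moreover have "linear (\<lambda>x::'a. x)"
    by (simp add: linear_iff)
  moreover have "?F z = z" if "z \<in> \<psi> ` {..<Q}" for z
  proof -
    from that obtain p where p: "p < Q" "z = \<psi> p"
      by auto
    have "?F z = (\<Sum>q<Q. if q = p then \<psi> p else 0)"
      using basis p unfolding orthonormal_basis_def by (intro sum.cong) auto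
    then show ?thesis
      using p by simp
  qed
  moreover have "x \<in> span (\<psi> ` {..<Q})"
    using assms by (simp add: orthonormal_basis_def)
  ultimately show ?thesis
    using linear_eq_on_span[of ?F "\<lambda>x. x"] by blast
qed

lemma orthonormal_basis_parseval:
  assumes "orthonormal_basis Q \<psi> S" and "x \<in> S"
  shows "(\<Sum>q<Q. (inner x (\<psi> q))\<^sup>2) = (norm x)\<^sup>2"
proof -
  have "(norm x)\<^sup>2 = inner x (\<Sum>q<Q. inner x (\<psi> q) *\<^sub>R \<psi> q)"
    using orthonormal_basis_expansion[OF assms] by (simp add: power2_norm_eq_inner)
  then show ?thesis
    by (simp add: inner_sum_right power2_eq_square)
qed

text \<open>The finite basis makes the component in \<open>S\<close> explicit as a Fourier sum; the
  remainder then meets the defining property of the projection onto the complement. The norm bound,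
  from Pythagoras, later allows \<open>norm s\<close> to be replaced by
  \<open>norm u\<close>.\<close>

lemma orth_proj_orthogonal_comp:
  assumes basis: "orthonormal_basis Q \<psi> S"
  obtains s where "s \<in> S" and "u = s + orth_proj (orthogonal_comp S) u" and "norm s \<le> norm u"
proof -
  define s where "s = (\<Sum>q<Q. inner u (\<psi> q) *\<^sub>R \<psi> q)"
  define p where "p = u - s"
  have S: "S = span (\<psi> ` {..<Q})"
    using basis by (simp add: orthonormal_basis_def)
  have s: "s \<in> S"
    unfolding S s_def by (intro span_sum span_scale span_base) auto
  have ps: "inner p (\<psi> r) = 0" if "r < Q" for r
  proof -
    have "inner s (\<psi> r) = (\<Sum>q<Q. if q = r then inner u (\<psi> r) else 0)"
      using basis that unfolding s_def inner_sum_left orthonormal_basis_def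
      by (intro sum.cong) auto
    then show ?thesis
      using that by (simp add: p_def inner_diff_left)
  qed
  have p: "p \<in> orthogonal_comp S"
  proof -
    have "orthogonal p x" if "x \<in> S" for x
      using that unfolding S
    proof (rule orthogonal_to_span)
      show "orthogonal p y" if "y \<in> \<psi> ` {..<Q}" for y
        using that ps by (auto simp: orthogonal_def)
    qed
    then show ?thesis
      by (auto simp: orthogonal_comp_def orthogonal_commute)
  qed
  have "orth_proj (orthogonal_comp S) u = p"
    unfolding orth_proj_def
  proof (rule the_equality)
    \<comment> \<open>Here \<open>u - p\<close> is \<open>s\<close>, and \<open>S\<close> lies in
      its double complement.\<close>
    show "p \<in> orthogonal_comp S \<and> u - p \<in> orthogonal_comp (orthogonal_comp S)"
      using p s by (auto simp: p_def orthogonal_comp_def orthogonal_commute)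
  next
    \<comment> \<open>Uniqueness, required by the definite description: the difference of two
      candidates lies both in the complement and in the double complement, so it is orthogonal to
      itself.\<close>
    fix p' assume p': "p' \<in> orthogonal_comp S \<and> u - p' \<in> orthogonal_comp (orthogonal_comp S)"
    have s': "s \<in> orthogonal_comp (orthogonal_comp S)"
      using s by (auto simp: orthogonal_comp_def orthogonal_commute)
    have "p - p' \<in> orthogonal_comp S"
      using p p' by (intro subspace_diff subspace_orthogonal_comp) auto
    moreover have "p - p' \<in> orthogonal_comp (orthogonal_comp S)"
    proof -
      have "p - p' = (u - p') - s"
        by (simp add: p_def)
      then show ?thesis
        using p' s' by (metis subspace_diff subspace_orthogonal_comp)
    qed
    ultimately have "orthogonal (p - p') (p - p')"
      by (auto simp: orthogonal_comp_def)
    then show "p' = p"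
      by (simp add: orthogonal_self)
  qed
  moreover have "norm s \<le> norm u"
  proof -
    have "orthogonal s p"
      using s p by (auto simp: orthogonal_comp_def)
    then have "(norm u)\<^sup>2 = (norm s)\<^sup>2 + (norm p)\<^sup>2"
      using norm_add_Pythagorean[of s p] by (simp add: p_def)
    then show ?thesis
      by (simp add: power2_le_imp_le)
  qed
  ultimately show ?thesis
    using that s by (simp add: p_def)
qed

section \<open>Bounds for the noiseless residual\<close>

lemma bounded_linear_meas: "bounded_linear (meas (l :: 'm::finite \<Rightarrow> 'u::real_normed_vector \<Rightarrow>\<^sub>L real))"
proof (rule bounded_linear_intro[where K = "\<Sum>i\<in>UNIV. norm (l i)"])
  fix u :: 'u
  \<comment> \<open>Passing from the Euclidean norm to the l1 norm yields the sum of the dual norms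
    as the constant \<open>K\<close>.\<close>
  have "norm (meas l u) \<le> (\<Sum>i\<in>UNIV. norm (meas l u $ i))"
    by (simp add: norm_le_l1_cart)
  also have "\<dots> \<le> (\<Sum>i\<in>UNIV. norm (l i) * norm u)"
    unfolding meas_def by (intro sum_mono) (simp only: vec_lambda_beta norm_blinfun)
  finally show "norm (meas l u) \<le> norm u * (\<Sum>i\<in>UNIV. norm (l i))"
    by (simp add: sum_distrib_left mult.commute)
qed (simp_all add: meas_def vec_eq_iff blinfun.add_right blinfun.scaleR_right)

text \<open>\<open>A\<close> is bounded because its domain is finite-dimensional. Boundedness of the
  residual map is what turns \<open>LambdaU\<close>, an \<open>onorm\<close>, into a valid upper
  bound.\<close>

lemma bounded_linear_alg_meas_residual:
  fixes l :: "'m::finite \<Rightarrow> 'u::real_normed_vector \<Rightarrow>\<^sub>L real"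
  assumes "linear A"
  shows "bounded_linear (\<lambda>u. u - alg_meas A l u)"
proof -
  have "bounded_linear A"
    using assms by (simp add: linear_conv_bounded_linear)
  then show ?thesis
    unfolding alg_meas_def
    by (intro bounded_linear_sub bounded_linear_ident bounded_linear_compose[OF _ bounded_linear_meas])
qed

text \<open>A real supremum dominates its family only if the family is bounded above;
  \<open>LambdaU A l\<close> bounds these quotients on the whole space.\<close>

lemma bdd_above_LambdaU_bias:
  fixes l :: "'m::finite \<Rightarrow> 'u::real_normed_vector \<Rightarrow>\<^sub>L real"
  assumes "linear A"
  shows "bdd_above ((\<lambda>u. norm (u - alg_meas A l u) / norm u) ` range A)"
  by (rule bdd_aboveI[where M = "LambdaU A l"])
    (auto simp: LambdaU_def intro!: le_onorm bounded_linear_alg_meas_residual assms)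

lemma norm_residual_le_LambdaU_bias:
  fixes l :: "'m::finite \<Rightarrow> 'u::real_normed_vector \<Rightarrow>\<^sub>L real"
  assumes "linear A" and "s \<in> range A"
  shows "norm (s - alg_meas A l s) \<le> LambdaU_bias A l * norm s"
proof (cases "s = 0")
  \<comment> \<open>At \<open>s = 0\<close> the quotient is \<open>0 / 0\<close> and says nothing,
    but the linear residual vanishes there.\<close>
  case True
  then show ?thesis
    using linear_0[OF bounded_linear.linear[OF bounded_linear_alg_meas_residual[OF assms(1), of l]]]
    by simp
next
  case False
  have "norm (s - alg_meas A l s) / norm s \<le> LambdaU_bias A l"
    unfolding LambdaU_bias_def using assms by (intro cSUP_upper bdd_above_LambdaU_bias)
  then show ?thesis
    using False by (simp add: field_simps)
qed

lemma LambdaU_bias_nonneg: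
  fixes l :: "'m::finite \<Rightarrow> 'u::real_normed_vector \<Rightarrow>\<^sub>L real"
  assumes "linear A"
  shows "0 \<le> LambdaU_bias A l"
  unfolding LambdaU_bias_def
  using assms by (intro cSUP_upper2[where x = "A 0"] bdd_above_LambdaU_bias) auto

text \<open>The residual map is linear, so it respects the splitting of \<open>u\<close>: the bias
  constant controls the part in the range, \<open>LambdaU\<close> the orthogonal part.\<close>

lemma norm_residual_le:
  fixes l :: "'m::finite \<Rightarrow> 'u::real_inner \<Rightarrow>\<^sub>L real"
  assumes A: "linear A" and basis: "orthonormal_basis Q \<psi> (range A)"
  shows "norm (u - alg_meas A l u)
    \<le> LambdaU A l * norm (orth_proj (orthogonal_comp (range A)) u) + LambdaU_bias A l * norm u"
proof -
  let ?R = "\<lambda>u. u - alg_meas A l u" and ?p = "orth_proj (orthogonal_comp (range A)) u"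
  note R = bounded_linear_alg_meas_residual[OF A, of l]
  obtain s where s: "s \<in> range A" "u = s + ?p" "norm s \<le> norm u"
    using orth_proj_orthogonal_comp[OF basis] .
  have "?R u = ?R s + ?R ?p"
    using linear_add[OF bounded_linear.linear[OF R], of s ?p] s(2) by simp
  then have "norm (?R u) \<le> norm (?R ?p) + norm (?R s)"
    by (metis add.commute norm_triangle_ineq)
  also have "\<dots> \<le> LambdaU A l * norm ?p + LambdaU_bias A l * norm s"
    unfolding LambdaU_def
    by (intro add_mono onorm[OF R] norm_residual_le_LambdaU_bias A s(1))
  also have "\<dots> \<le> LambdaU A l * norm ?p + LambdaU_bias A l * norm u"
    by (intro add_left_mono mult_left_mono s(3) LambdaU_bias_nonneg A)
  finally show ?thesis .
qed

section \<open>Trace formula and second moments of the noise\<close>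

text \<open>The diagonal entry at \<open>m\<close> is the sum of the squared coefficients of
  \<open>A (axis m 1)\<close>, to which Parseval applies.\<close>

lemma trace_transpose_mult_self_alg_mat:
  fixes A :: "real ^ 'm::finite \<Rightarrow> 'u::real_inner"
  assumes "orthonormal_basis Q \<psi> (range A)"
  shows "trace (transpose_mult_self Q (alg_mat A \<psi>)) = (\<Sum>m\<in>UNIV. (norm (A (axis m 1)))\<^sup>2)"
  using orthonormal_basis_parseval[OF assms]
  by (simp add: trace_def transpose_mult_self_def alg_mat_def flip: power2_eq_square)

lemma integrable_mult_of_square_integrable:
  fixes X Y :: "'w \<Rightarrow> real"
  assumes "X \<in> borel_measurable M" "Y \<in> borel_measurable M"
    and "integrable M (\<lambda>w. (X w)\<^sup>2)" "integrable M (\<lambda>w. (Y w)\<^sup>2)"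
  shows "integrable M (\<lambda>w. X w * Y w)"
proof (rule Bochner_Integration.integrable_bound)
  show "integrable M (\<lambda>w. (X w)\<^sup>2 + (Y w)\<^sup>2)"
    using assms by simp
  \<comment> \<open>The dominating function comes from
    \<open>2 * a * b \<le> a\<^sup>2 + b\<^sup>2\<close> at the absolute values; the factor 2 is
    dropped by nonnegativity.\<close>
  have "\<bar>X w * Y w\<bar> \<le> (X w)\<^sup>2 + (Y w)\<^sup>2" for w
    using sum_squares_bound[of "\<bar>X w\<bar>" "\<bar>Y w\<bar>"] abs_ge_zero[of "X w * Y w"]
    unfolding abs_mult power2_abs by linarith
  then show "AE w in M. norm (X w * Y w) \<le> norm ((X w)\<^sup>2 + (Y w)\<^sup>2)"
    by (auto intro: order_trans[OF _ abs_ge_self])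
qed (use assms in simp)

text \<open>Expand the square around the deterministic \<open>c\<close>: zero means remove the terms
  linear in \<open>X\<close>, and independence removes the off-diagonal quadratic terms.\<close>

lemma (in prob_space) expectation_norm_noise:
  fixes X :: "'m::finite \<Rightarrow> 'a \<Rightarrow> real" and c :: "'u::real_inner" and v :: "'m \<Rightarrow> 'u"
  assumes indep: "indep_vars (\<lambda>_. borel) X UNIV"
    and mv: "\<And>i. has_mean_variance M (X i) 0 (\<sigma>\<^sup>2)"
  shows "integrable M (\<lambda>w. (norm (c + (\<Sum>i\<in>UNIV. X i w *\<^sub>R v i)))\<^sup>2)"
    and "expectation (\<lambda>w. (norm (c + (\<Sum>i\<in>UNIV. X i w *\<^sub>R v i)))\<^sup>2)
      = (norm c)\<^sup>2 + \<sigma>\<^sup>2 * (\<Sum>i\<in>UNIV. (norm (v i))\<^sup>2)"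
proof -
  have meas [measurable]: "X i \<in> borel_measurable M" and sq: "integrable M (\<lambda>w. (X i w)\<^sup>2)"
    and mean: "expectation (X i) = 0" and "variance (X i) = \<sigma>\<^sup>2" for i
    using mv[of i] by (auto simp: has_mean_variance_def)
  \<comment> \<open>With mean 0 the variance is the second moment.\<close>
  then have var: "expectation (\<lambda>w. (X i w)\<^sup>2) = \<sigma>\<^sup>2" for i
    by simp
  have int: "integrable M (X i)" for i
    using square_integrable_imp_integrable[OF meas sq] .
  have int2: "integrable M (\<lambda>w. X i w * X j w)" for i j
    using integrable_mult_of_square_integrable[OF meas meas sq sq] .
  have cov: "expectation (\<lambda>w. X i w * X j w) = (if i = j then \<sigma>\<^sup>2 else 0)" for i j
  proof (cases "i = j")
    case True
    then show ?thesis
      using var by (simp add: power2_eq_square)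
  next
    case False
    \<comment> \<open>Restricted to two distinct indices, independence factors the expectation of
      the product, and both factors are 0.\<close>
    have "indep_vars (\<lambda>_. borel) X {i, j}"
      by (rule indep_vars_subset[OF indep]) simp
    then have "expectation (\<lambda>w. \<Prod>k\<in>{i, j}. X k w) = (\<Prod>k\<in>{i, j}. expectation (X k))"
      by (intro indep_vars_lebesgue_integral) (auto simp: int)
    then show ?thesis
      using False mean by simp
  qed
  have eq: "(norm (c + (\<Sum>i\<in>UNIV. X i w *\<^sub>R v i)))\<^sup>2 = (norm c)\<^sup>2
      + 2 * (\<Sum>i\<in>UNIV. X i w * inner c (v i))
      + (\<Sum>i\<in>UNIV. \<Sum>j\<in>UNIV. X i w * X j w * inner (v i) (v j))" for w
    by (simp add: power2_norm_eq_inner inner_add_left inner_add_right inner_sum_left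
        inner_sum_right inner_commute sum_distrib_left mult_ac)
  show "integrable M (\<lambda>w. (norm (c + (\<Sum>i\<in>UNIV. X i w *\<^sub>R v i)))\<^sup>2)"
    unfolding eq by (simp add: int int2)
  show "expectation (\<lambda>w. (norm (c + (\<Sum>i\<in>UNIV. X i w *\<^sub>R v i)))\<^sup>2)
      = (norm c)\<^sup>2 + \<sigma>\<^sup>2 * (\<Sum>i\<in>UNIV. (norm (v i))\<^sup>2)"
    unfolding eq
    \<comment> \<open>Moving the multiplication inside the \<open>if\<close> of \<open>cov\<close>
      collapses the double sum to its diagonal.\<close>
    by (simp add: int int2 mean cov prob_space if_distrib[of "\<lambda>x. x * _"] power2_norm_eq_inner
        sum_distrib_left cong: if_cong)
qed

theorem proposition3p1:
  fixes l :: "'m::finite \<Rightarrow> 'u::{real_inner, banach} \<Rightarrow>\<^sub>L real"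
    and A :: "real ^ 'm \<Rightarrow> 'u"
    and \<psi> :: "nat \<Rightarrow> 'u"
    and utrue :: 'u
    and y :: "real ^ 'm"
  assumes "inj l" and "independent (range l)"
    and "linear A"
    and "orthonormal_basis (dim (range A)) \<psi> (range A)"
  shows "norm (A y - utrue)
          \<le> Lambda2 A * norm (y - meas l utrue)
            + LambdaU A l * norm (orth_proj (orthogonal_comp (range A)) utrue)
            + LambdaU_bias A l * norm utrue
    \<and> (\<forall>(P :: 'w measure) (\<epsilon> :: 'm \<Rightarrow> 'w \<Rightarrow> real) (Y :: 'w \<Rightarrow> real ^ 'm) (\<sigma> :: real).
          prob_space P \<longrightarrow>
          iid P \<epsilon> \<longrightarrow>
          (\<forall>i. has_mean_variance P (\<epsilon> i) 0 (\<sigma>\<^sup>2)) \<longrightarrow>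
          (\<forall>w\<in>space P. Y w = meas l utrue + (\<chi> i. \<epsilon> i w)) \<longrightarrow>
          integrable P (\<lambda>w. (norm (A (Y w) - utrue))\<^sup>2) \<and>
          prob_space.expectation P (\<lambda>w. (norm (A (Y w) - utrue))\<^sup>2)
          \<le> (LambdaU A l * norm (orth_proj (orthogonal_comp (range A)) utrue)
               + LambdaU_bias A l * norm utrue)\<^sup>2
            + \<sigma>\<^sup>2 * trace (transpose_mult_self (dim (range A)) (alg_mat A \<psi>)))"
proof -
  let ?B = "LambdaU A l * norm (orth_proj (orthogonal_comp (range A)) utrue)
    + LambdaU_bias A l * norm utrue"
  note A = assms(3)
  note basis = assms(4)
  have residual: "norm (alg_meas A l utrue - utrue) \<le> ?B"
    using norm_residual_le[OF A basis] by (simp add: norm_minus_commute)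
  show ?thesis
  proof (intro conjI allI impI)
    have "A y - utrue = A (y - meas l utrue) + (alg_meas A l utrue - utrue)"
      by (simp add: linear_diff[OF A] alg_meas_def)
    then have "norm (A y - utrue)
        \<le> norm (A (y - meas l utrue)) + norm (alg_meas A l utrue - utrue)"
      by (metis norm_triangle_ineq)
    also have "\<dots> \<le> Lambda2 A * norm (y - meas l utrue) + ?B"
      unfolding Lambda2_def
      using A by (intro add_mono onorm residual) (simp add: linear_conv_bounded_linear)
    finally show "norm (A y - utrue)
          \<le> Lambda2 A * norm (y - meas l utrue)
            + LambdaU A l * norm (orth_proj (orthogonal_comp (range A)) utrue)
            + LambdaU_bias A l * norm utrue"
      by simp
  next
    fix P :: "'w measure" and \<epsilon> :: "'m \<Rightarrow> 'w \<Rightarrow> real" and Y :: "'w \<Rightarrow> real ^ 'm" and \<sigma> :: real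
    assume P: "prob_space P" and iid: "iid P \<epsilon>"
      and mv: "\<forall>i. has_mean_variance P (\<epsilon> i) 0 (\<sigma>\<^sup>2)"
      and Y: "\<forall>w\<in>space P. Y w = meas l utrue + (\<chi> i. \<epsilon> i w)"
    interpret prob_space P by (rule P)
    let ?c = "alg_meas A l utrue - utrue" and ?v = "\<lambda>m. A (axis m 1)"
    \<comment> \<open>The noise is expanded in unit vectors, so the error is the fixed vector
      \<open>?c\<close> plus a random combination of the \<open>?v i\<close>. \<open>Y\<close> is
      prescribed only on \<open>space P\<close>, hence the congruence rules for the integrals
      below.\<close>
    have err: "(norm (A (Y w) - utrue))\<^sup>2 = (norm (?c + (\<Sum>i\<in>UNIV. \<epsilon> i w *\<^sub>R ?v i)))\<^sup>2"
      if "w \<in> space P" for w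
    proof -
      have "(\<chi> i. \<epsilon> i w) = (\<Sum>i\<in>UNIV. \<epsilon> i w *\<^sub>R axis i 1)"
        using basis_expansion[of "\<chi> i. \<epsilon> i w"] by (simp add: scalar_mult_eq_scaleR)
      then have "A (\<chi> i. \<epsilon> i w) = (\<Sum>i\<in>UNIV. \<epsilon> i w *\<^sub>R ?v i)"
        by (simp add: linear_sum[OF A] linear_scale[OF A])
      then show ?thesis
        using Y that by (simp add: linear_add[OF A] alg_meas_def algebra_simps)
    qed
    have "indep_vars (\<lambda>_. borel) \<epsilon> UNIV"
      using iid by (simp add: iid_def)
    note noise = expectation_norm_noise[OF this spec[OF mv], of ?c ?v]
    show "integrable P (\<lambda>w. (norm (A (Y w) - utrue))\<^sup>2)"
      using noise(1) by (simp add: err cong: Bochner_Integration.integrable_cong)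
    have "expectation (\<lambda>w. (norm (A (Y w) - utrue))\<^sup>2)
        = (norm ?c)\<^sup>2 + \<sigma>\<^sup>2 * trace (transpose_mult_self (dim (range A)) (alg_mat A \<psi>))"
      using noise(2)
      by (simp add: err trace_transpose_mult_self_alg_mat[OF basis]
          cong: Bochner_Integration.integral_cong)
    \<comment> \<open>The second moment is known exactly; the inequality comes only from bounding
      the norm of \<open>?c\<close> by \<open>?B\<close>.\<close>
    then show "expectation (\<lambda>w. (norm (A (Y w) - utrue))\<^sup>2)
        \<le> ?B\<^sup>2 + \<sigma>\<^sup>2 * trace (transpose_mult_self (dim (range A)) (alg_mat A \<psi>))"
      using residual by (simp add: power_mono)
  qed
qed

end
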